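(* Let $G$ be a connected minimal DTDP-graph and let $(D,T)$ be a DT-pair of $G$. Then: (1) $D$ is a maximal independent set of $G$; (2) every component of the subgraph $G[T]$ induced by $T$ is either a star $K_{1,n}$ ($n\ge1$) or a graph with one vertex and one loop; (3) for every $x\in T$, either $|N_G(x)\setminus T|=1$ or $N_G(x)\setminus T$ is a nonempty subset of $L_G$; moreover, if $x$ is a leaf of a star of order at least $3$ that is a component of $G[T]$, then $N_G(x)\setminus T$ is a nonempty subset of $L_G$; (4) $G$ is isomorphic to a 2-subdivision graph $S_2(H,\mathcal{P},\theta)$ for some connected graph $H$, some family $\mathcal{P}=\{\mathcal{P}(v):v\in V_H\}$ with $\mathcal{P}(v)$ a partition of $N_{S_2(H)}(v)$, and some function $\theta$ from the leaves of $S_2(H,\mathcal{P})$ to the positive integers.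
   Context: Graphs may have multiple edges and multiple loops. For a vertex $v$, $N_G(v)$ is the set of vertices adjacent to $v$ (a vertex with a loop is its own neighbour); degree counts loops twice; a leaf is a vertex of degree 1 and $L_G$ is the set of leaves. A set $D$ is dominating if every vertex not in $D$ has a neighbour in $D$; $T$ is total dominating if every vertex (including those in $T$) has a neighbour in $T$. A DT-pair is a pair of disjoint sets $(D,T)$ with $D$ dominating and $T$ total dominating; a graph is a DTDP-graph if it has a DT-pair. A connected graph is a minimal DTDP-graph if it is a DTDP-graph and no proper spanning subgraph (same vertex set, proper subset of edges and loops) is a DTDP-graph. 2-subdivision graphs: $S_2(H)$ is obtained from $H$ by inserting two new vertices into each edge and loop: for an edge $e$ with ends $u\ne v$ add $u_e,v_e$ and edges $uu_e,u_ev_e,v_ev$; for a loop $e$ at $v$ add $v_e^1,v_e^2$ and edges $vv_e^1,v_e^1v_e^2,v_e^2v$. $N_{S_2(H)}(v)$ is the set of new vertices adjacent to $v\in V_H$. $S_2(H,\mathcal{P})$ has vertex set $V_H\cup\{(v,A):A\in\mathcal{P}(v)\}$; each $v$ is joined by one edge to each $(v,A)$; each edge $e$ of $H$ with ends $u\ne v$ gives one edge joining $(u,B)$ and $(v,A)$ where $u_e\in B$, $v_e\in A$; each loop $e$ at $v$ gives one edge joining $(v,A)$, $(v,A')$ with $v_e^1\in A$, $v_e^2\in A'$ (a loop if $A=A'$). $S_2(H,\mathcal{P},\theta)$ replaces each leaf $x$ of $S_2(H,\mathcal{P})$ by $\theta(x)$ leaves adjacent to the neighbour of $x$. *)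

theory Defs
  imports Main "HOL-Library.Disjoint_Sets"
begin

text \<open>
  Finite undirected graphs in which multiple edges and multiple loops are allowed. Edges are
  named objects; an edge has two ends, or a single end if it is a loop. The value of
  \<open>ends\<close> outside of \<open>edges\<close> is irrelevant.
\<close>

record ('v, 'e) mgraph =
  verts :: "'v set"
  edges :: "'e set"
  ends :: "'e \<Rightarrow> 'v set"

definition multigraph :: "('v, 'e) mgraph \<Rightarrow> bool" where
  "multigraph G \<longleftrightarrow> finite (verts G) \<and> finite (edges G) \<and>
     (\<forall>e\<in>edges G. ends G e \<subseteq> verts G \<and> (card (ends G e) = 1 \<or> card (ends G e) = 2))"

definition is_loop :: "('v, 'e) mgraph \<Rightarrow> 'e \<Rightarrow> bool" where
  "is_loop G e \<longleftrightarrow> card (ends G e) = 1"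

definition adjacent :: "('v, 'e) mgraph \<Rightarrow> 'v \<Rightarrow> 'v \<Rightarrow> bool" where
  "adjacent G u v \<longleftrightarrow> (\<exists>e\<in>edges G. ends G e = {u, v})"

definition nbrs :: "('v, 'e) mgraph \<Rightarrow> 'v \<Rightarrow> 'v set" where
  "nbrs G v = {u \<in> verts G. adjacent G v u}"

definition degree :: "('v, 'e) mgraph \<Rightarrow> 'v \<Rightarrow> nat" where
  "degree G v = card {e \<in> edges G. v \<in> ends G e} + card {e \<in> edges G. v \<in> ends G e \<and> is_loop G e}"

definition leaves :: "('v, 'e) mgraph \<Rightarrow> 'v set" where
  "leaves G = {v \<in> verts G. degree G v = 1}"

definition gconnected :: "('v, 'e) mgraph \<Rightarrow> bool" where
  "gconnected G \<longleftrightarrow> verts G \<noteq> {} \<and> (\<forall>u\<in>verts G. \<forall>v\<in>verts G. (adjacent G)\<^sup>*\<^sup>* u v)"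

definition induced :: "('v, 'e) mgraph \<Rightarrow> 'v set \<Rightarrow> ('v, 'e) mgraph" where
  "induced G S = \<lparr>verts = S, edges = {e \<in> edges G. ends G e \<subseteq> S}, ends = ends G\<rparr>"

definition components :: "('v, 'e) mgraph \<Rightarrow> ('v, 'e) mgraph set" where
  "components G = {induced G {u \<in> verts G. (adjacent G)\<^sup>*\<^sup>* v u} |v. v \<in> verts G}"

definition isomorphic :: "('v, 'e) mgraph \<Rightarrow> ('w, 'f) mgraph \<Rightarrow> bool" where
  "isomorphic G K \<longleftrightarrow> (\<exists>f g. bij_betw f (verts G) (verts K) \<and> bij_betw g (edges G) (edges K) \<and>
     (\<forall>e\<in>edges G. ends K (g e) = f ` ends G e))"

definition star :: "nat \<Rightarrow> (nat, nat) mgraph" where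
  "star n = \<lparr>verts = {0..n}, edges = {1..n}, ends = (\<lambda>i. {0, i})\<rparr>"

definition is_star :: "('v, 'e) mgraph \<Rightarrow> bool" where
  "is_star C \<longleftrightarrow> (\<exists>n\<ge>1. isomorphic C (star n))"

definition is_one_vertex_one_loop :: "('v, 'e) mgraph \<Rightarrow> bool" where
  "is_one_vertex_one_loop C \<longleftrightarrow> (\<exists>v e. verts C = {v} \<and> edges C = {e} \<and> ends C e = {v})"

text \<open>A vertex with a loop is its own neighbour, hence it belongs to no independent set.\<close>

definition independent :: "('v, 'e) mgraph \<Rightarrow> 'v set \<Rightarrow> bool" where
  "independent G S \<longleftrightarrow> S \<subseteq> verts G \<and> (\<forall>u\<in>S. \<forall>v\<in>S. v \<notin> nbrs G u)"

definition maximal_independent :: "('v, 'e) mgraph \<Rightarrow> 'v set \<Rightarrow> bool" where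
  "maximal_independent G S \<longleftrightarrow> independent G S \<and> (\<forall>S'. independent G S' \<and> S \<subseteq> S' \<longrightarrow> S' = S)"

definition dominating :: "('v, 'e) mgraph \<Rightarrow> 'v set \<Rightarrow> bool" where
  "dominating G D \<longleftrightarrow> D \<subseteq> verts G \<and> (\<forall>v\<in>verts G - D. nbrs G v \<inter> D \<noteq> {})"

definition total_dominating :: "('v, 'e) mgraph \<Rightarrow> 'v set \<Rightarrow> bool" where
  "total_dominating G T \<longleftrightarrow> T \<subseteq> verts G \<and> (\<forall>v\<in>verts G. nbrs G v \<inter> T \<noteq> {})"

definition DT_pair :: "('v, 'e) mgraph \<Rightarrow> 'v set \<Rightarrow> 'v set \<Rightarrow> bool" where
  "DT_pair G D T \<longleftrightarrow> D \<inter> T = {} \<and> dominating G D \<and> total_dominating G T"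

definition DTDP :: "('v, 'e) mgraph \<Rightarrow> bool" where
  "DTDP G \<longleftrightarrow> (\<exists>D T. DT_pair G D T)"

definition minimal_DTDP :: "('v, 'e) mgraph \<Rightarrow> bool" where
  "minimal_DTDP G \<longleftrightarrow> gconnected G \<and> DTDP G \<and> (\<forall>F. F \<subset> edges G \<longrightarrow> \<not> DTDP (G\<lparr>edges := F\<rparr>))"

text \<open>
  The vertices of the graph $S_2(H)$: \<open>Orig v\<close> is the vertex $v$ of $H$, \<open>Sub v e\<close> is the vertex
  $v_e$ inserted next to the end $v$ of the non-loop $e$, and \<open>LoopSub1 v e\<close>, \<open>LoopSub2 v e\<close> are the
  vertices $v_e^1$, $v_e^2$ inserted into the loop $e$ at $v$. In all cases \<open>owner\<close> yields $v$.
  The edge \<open>Link x\<close> joins the new vertex $x$ to its owner, and \<open>Mid e\<close> joins the two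
  new vertices inserted into $e$.
\<close>

datatype ('v, 'e) s2_vertex =
    Orig (owner: 'v)
  | Sub (owner: 'v) 'e
  | LoopSub1 (owner: 'v) 'e
  | LoopSub2 (owner: 'v) 'e

datatype ('v, 'e) s2_edge = Link "('v, 'e) s2_vertex" | Mid 'e

definition new_verts :: "('v, 'e) mgraph \<Rightarrow> 'e \<Rightarrow> ('v, 'e) s2_vertex set" where
  "new_verts H e = (if is_loop H e then {LoopSub1 v e |v. v \<in> ends H e} \<union> {LoopSub2 v e |v. v \<in> ends H e}
                    else {Sub v e |v. v \<in> ends H e})"

definition S2 :: "('v, 'e) mgraph \<Rightarrow> (('v, 'e) s2_vertex, ('v, 'e) s2_edge) mgraph" where
  "S2 H = \<lparr>verts = Orig ` verts H \<union> (\<Union>e\<in>edges H. new_verts H e),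
           edges = Link ` (\<Union>e\<in>edges H. new_verts H e) \<union> Mid ` edges H,
           ends = (\<lambda>a. case a of Link x \<Rightarrow> {Orig (owner x), x} | Mid e \<Rightarrow> new_verts H e)\<rparr>"

definition S2_family :: "('v, 'e) mgraph \<Rightarrow> ('v \<Rightarrow> ('v, 'e) s2_vertex set set) \<Rightarrow> bool" where
  "S2_family H P \<longleftrightarrow> (\<forall>v\<in>verts H. partition_on (nbrs (S2 H) (Orig v)) (P v))"

text \<open>
  In $S_2(H,\mathcal{P})$ an edge $e$ of $H$ becomes an edge joining the blocks that contain the new
  vertices of $e$; it is a loop if $e$ is a loop and both of its new vertices lie in the same block.
\<close>

datatype ('v, 'e) s2p_vertex = Base 'v | Block 'v "('v, 'e) s2_vertex set"

datatype ('v, 'e) s2p_edge = Spoke 'v "('v, 'e) s2_vertex set" | Across 'e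

definition S2P :: "('v, 'e) mgraph \<Rightarrow> ('v \<Rightarrow> ('v, 'e) s2_vertex set set)
    \<Rightarrow> (('v, 'e) s2p_vertex, ('v, 'e) s2p_edge) mgraph" where
  "S2P H P = \<lparr>verts = Base ` verts H \<union> {Block v A |v A. v \<in> verts H \<and> A \<in> P v},
              edges = {Spoke v A |v A. v \<in> verts H \<and> A \<in> P v} \<union> Across ` edges H,
              ends = (\<lambda>a. case a of
                  Spoke v A \<Rightarrow> {Base v, Block v A}
                | Across e \<Rightarrow> {Block v A |v A. v \<in> verts H \<and> A \<in> P v \<and> A \<inter> new_verts H e \<noteq> {}})\<rparr>"

text \<open>
  Replacing each leaf $x$ of a graph by \<open>\<theta> x\<close> leaves adjacent to the neighbour of $x$: the new
  leaves are the pairs \<open>(x, i)\<close> with \<open>i < \<theta> x\<close>, each with its own copy \<open>(e, i)\<close> of the edge $e$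
  incident with $x$; every other vertex or edge only has the copy with index 0. In the graphs
  $S_2(H,\mathcal{P})$ no edge joins two leaves, since the degree of \<open>Block v A\<close> is at least 2.
\<close>

definition multiply_leaves :: "('v, 'e) mgraph \<Rightarrow> ('v \<Rightarrow> nat) \<Rightarrow> ('v \<times> nat, 'e \<times> nat) mgraph" where
  "multiply_leaves K \<theta> =
     \<lparr>verts = {(x, i). x \<in> verts K \<and> (if x \<in> leaves K then i < \<theta> x else i = 0)},
      edges = {(e, i). e \<in> edges K \<and>
                 (if ends K e \<inter> leaves K = {} then i = 0 else \<forall>x \<in> ends K e \<inter> leaves K. i < \<theta> x)},
      ends = (\<lambda>(e, i). (\<lambda>x. (x, if x \<in> leaves K then i else 0)) ` ends K e)\<rparr>"

definition S2PT :: "('v, 'e) mgraph \<Rightarrow> ('v \<Rightarrow> ('v, 'e) s2_vertex set set)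
    \<Rightarrow> (('v, 'e) s2p_vertex \<Rightarrow> nat)
    \<Rightarrow> (('v, 'e) s2p_vertex \<times> nat, ('v, 'e) s2p_edge \<times> nat) mgraph" where
  "S2PT H P \<theta> = multiply_leaves (S2P H P) \<theta>"

end

theory Submission
  imports Defs
begin

text \<open>
  Deleting an edge \<open>e\<close> destroys every DT-pair, so \<open>e\<close> has an end \<open>v\<close> for which \<open>e\<close> is either the only
  edge from \<open>v\<close> to \<open>T\<close>, or \<open>v \<notin> D\<close> and \<open>e\<close> is the only edge from \<open>v\<close> to \<open>D\<close>. Hence \<open>D\<close> is
  independent and equals the complement of \<open>T\<close>, every edge inside \<open>T\<close> has an end that is
  incident with no other edge inside \<open>T\<close>, and the edges between \<open>D\<close> and \<open>T\<close> form disjoint stars.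
  The graph \<open>H\<close> arises by contracting each of these last stars to a vertex; its edges are
  the edges inside \<open>T\<close>, and each \<open>x \<in> T\<close> is the block of the half-edges at \<open>x\<close>.
\<close>

subsection \<open>Multigraphs, components and stars\<close>

lemma adjacent_sym: "adjacent G u v \<longleftrightarrow> adjacent G v u"
  by (simp add: adjacent_def insert_commute)

lemma multigraph_ends:
  assumes "multigraph G" "e \<in> edges G"
  obtains u v where "ends G e = {u, v}" "u \<in> verts G" "v \<in> verts G"
proof -
  have "ends G e \<subseteq> verts G" "card (ends G e) = 1 \<or> card (ends G e) = 2"
    using assms by (auto simp: multigraph_def)
  then show thesis
    by (metis card_1_singletonE card_2_iff insert_absorb2 insert_subset that)
qed

lemma ends_eqI:
  assumes "multigraph G" "e \<in> edges G" "u \<in> ends G e"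
  obtains v where "ends G e = {u, v}"
  using multigraph_ends[OF assms(1,2)] assms(3) by (metis insert_commute insert_iff singletonD)

lemma multigraph_induced: "multigraph G \<Longrightarrow> S \<subseteq> verts G \<Longrightarrow> multigraph (induced G S)"
  by (auto simp: multigraph_def induced_def intro: finite_subset)

text \<open>A loop contributes 2 to the degree, so degree 1 leaves room for a single incident edge
  that is not a loop. Leaves are tested in this form below.\<close>

lemma leaves_iff:
  assumes "finite (edges G)"
  shows "v \<in> leaves G \<longleftrightarrow>
    v \<in> verts G \<and> (\<exists>e. {e \<in> edges G. v \<in> ends G e} = {e} \<and> \<not> is_loop G e)"
proof -
  define A where "A = {e \<in> edges G. v \<in> ends G e}"
  have "{e \<in> edges G. v \<in> ends G e \<and> is_loop G e} = {e \<in> A. is_loop G e}"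
    by (auto simp: A_def)
  then have deg: "degree G v = card A + card {e \<in> A. is_loop G e}"
    by (simp add: degree_def A_def)
  have fin: "finite A" using assms by (simp add: A_def)
  have "degree G v = 1 \<longleftrightarrow> (\<exists>e. A = {e} \<and> \<not> is_loop G e)"
  proof
    assume deg1: "degree G v = 1"
    then have "card A \<noteq> 0" using deg fin by auto
    then have "card A = 1" "card {e \<in> A. is_loop G e} = 0" using deg deg1 by linarith+
    then obtain e where e: "A = {e}" and "{e' \<in> A. is_loop G e'} = {}"
      using fin by (auto simp: card_1_singleton_iff)
    then have "\<not> is_loop G e" by auto
    with e show "\<exists>e. A = {e} \<and> \<not> is_loop G e" by blast
  next
    assume "\<exists>e. A = {e} \<and> \<not> is_loop G e"
    then obtain e where e: "A = {e}" "\<not> is_loop G e" by blast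
    then have "{e' \<in> A. is_loop G e'} = {}" by auto
    then show "degree G v = 1" using deg e(1) by (simp only:) simp
  qed
  then show ?thesis by (simp add: leaves_def A_def)
qed

text \<open>The other end of the edge is reachable by one more step, so both ends lie in the
  reachability class that spans the component.\<close>

lemma component_edge:
  assumes K: "multigraph K" and C: "C \<in> components K"
    and e: "e \<in> edges K" "u \<in> ends K e" "u \<in> verts C"
  shows "e \<in> edges C"
proof -
  obtain v where v: "C = induced K {u \<in> verts K. (adjacent K)\<^sup>*\<^sup>* v u}"
    using C by (auto simp: components_def)
  obtain w where w: "ends K e = {u, w}" by (rule ends_eqI[OF K e(1,2)])
  have "adjacent K u w" using e(1) w by (auto simp: adjacent_def)
  moreover have "(adjacent K)\<^sup>*\<^sup>* v u" using e(3) v by (simp add: induced_def)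
  ultimately have "(adjacent K)\<^sup>*\<^sup>* v w" by (rule rtranclp.rtrancl_into_rtrancl[rotated])
  then show ?thesis using e w v K by (auto simp: induced_def multigraph_def)
qed

text \<open>Reachability is symmetric, so any vertex of \<open>C\<close> may serve as the starting
  point. Components are bounded from above by exhibiting a set closed under adjacency.\<close>

lemma component_subset:
  assumes C: "C \<in> components K"
    and c: "c \<in> verts C" "c \<in> X"
    and X: "\<And>u w. u \<in> X \<Longrightarrow> adjacent K u w \<Longrightarrow> w \<in> X"
  shows "verts C \<subseteq> X"
proof
  fix u assume u: "u \<in> verts C"
  obtain v where v: "C = induced K {u \<in> verts K. (adjacent K)\<^sup>*\<^sup>* v u}"
    using C by (auto simp: components_def)
  have "symp (adjacent K)" by (auto intro: sympI simp: adjacent_sym)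
  then have "(adjacent K)\<^sup>*\<^sup>* c v"
    using c v by (auto simp: induced_def intro: sympD[OF symp_rtranclp])
  then have "(adjacent K)\<^sup>*\<^sup>* c u"
    using u v by (auto simp: induced_def intro: rtranclp_trans)
  then show "u \<in> X" by (induction rule: rtranclp_induct) (use c X in auto)
qed

lemma component_simps:
  assumes "C \<in> components K"
  shows "edges C = {e \<in> edges K. ends K e \<subseteq> verts C}" "ends C = ends K" "verts C \<subseteq> verts K"
    "verts C \<noteq> {}"
  using assms by (auto simp: components_def induced_def)

text \<open>The map \<open>l\<close> gives the end of an edge other than the centre
  \<open>c\<close>. Numbering the edges from 1 to n numbers these ends as well, and the centre
  receives 0.\<close>

lemma is_starI:
  assumes "finite (edges C)" "edges C \<noteq> {}" "inj_on l (edges C)" "c \<notin> l ` edges C"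
    and verts: "verts C = insert c (l ` edges C)"
    and ends: "\<And>e. e \<in> edges C \<Longrightarrow> ends C e = {c, l e}"
  shows "is_star C"
proof -
  define n where "n = card (edges C)"
  have n1: "n \<ge> 1" using assms(1,2) by (simp add: n_def card_gt_0_iff Suc_leI)
  obtain g where g: "bij_betw g (edges C) {1..n}"
    using ex_bij_betw_nat_finite_1[OF assms(1)] bij_betw_inv unfolding n_def by blast
  define f where "f v = (if v = c then 0 else g (the_inv_into (edges C) l v))" for v
  have fl: "f (l e) = g e" if "e \<in> edges C" for e
    using that assms(3,4) by (auto simp: f_def the_inv_into_f_f)
  have fc: "f c = 0" by (simp add: f_def)
  have "f ` verts C = insert 0 (g ` edges C)"
    unfolding verts by (simp add: fc image_image fl)
  also have "\<dots> = {0..n}" using g by (auto simp: bij_betw_def)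
  finally have im: "f ` verts C = {0..n}" .
  have "card (verts C) = n + 1"
    unfolding verts n_def using assms(1,3,4) by (simp add: card_image)
  \<comment> \<open>Injectivity by counting: \<open>f\<close> maps a set of n + 1 vertices onto a
    set of n + 1 numbers.\<close>
  then have "inj_on f (verts C)"
    using im by (intro eq_card_imp_inj_on) (auto simp: verts assms(1))
  then have "bij_betw f (verts C) (verts (star n))"
    using im by (simp add: bij_betw_def star_def)
  moreover have "bij_betw g (edges C) (edges (star n))"
    using g by (simp add: star_def)
  moreover have "\<forall>e\<in>edges C. ends (star n) (g e) = f ` ends C e"
    by (simp add: ends fl fc star_def)
  ultimately show ?thesis
    using n1 unfolding is_star_def isomorphic_def by blast
qed

subsection \<open>Critical edges\<close>

text \<open>The pair is a parameter, so that what is proved for \<open>(D, T)\<close> can also be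
  applied to another DT-pair of the same graph.\<close>

locale minimal_DT =
  fixes G :: "('v, 'e) mgraph" and D T :: "'v set"
  assumes multigraph: "multigraph G"
    and minimal: "minimal_DTDP G"
    and DT: "DT_pair G D T"
begin

lemma disjoint: "D \<inter> T = {}" and DV: "D \<subseteq> verts G" and TV: "T \<subseteq> verts G"
  using DT by (auto simp: DT_pair_def dominating_def total_dominating_def)

lemma finite_verts: "finite (verts G)" and finite_edges: "finite (edges G)"
  using multigraph by (auto simp: multigraph_def)

lemma not_DT_pair_delete: "e \<in> edges G \<Longrightarrow> \<not> DT_pair (G\<lparr>edges := edges G - {e}\<rparr>) D' T'"
  using minimal unfolding minimal_DTDP_def DTDP_def by blast

lemma ex_T_edge:
  assumes "v \<in> verts G"
  obtains e w where "e \<in> edges G" "ends G e = {v, w}" "w \<in> T"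
proof -
  have "nbrs G v \<inter> T \<noteq> {}" using DT assms by (auto simp: DT_pair_def total_dominating_def)
  then show thesis using that by (auto simp: nbrs_def adjacent_def)
qed

lemma ex_D_edge:
  assumes "v \<in> verts G" "v \<notin> D"
  obtains e w where "e \<in> edges G" "ends G e = {v, w}" "w \<in> D"
proof -
  have "nbrs G v \<inter> D \<noteq> {}" using DT assms by (auto simp: DT_pair_def dominating_def)
  then show thesis using that by (auto simp: nbrs_def adjacent_def)
qed

text \<open>If both alternatives failed, every vertex would keep its required neighbours without
  \<open>e\<close>, and \<open>(D, T)\<close> would remain a DT-pair. The condition
  \<open>v \<notin> D\<close> appears only in the second alternative because vertices of
  \<open>D\<close> need no neighbour in \<open>D\<close>, whereas every vertex needs one in
  \<open>T\<close>.\<close>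

lemma edge_critical:
  assumes e: "e \<in> edges G"
  obtains v w where "ends G e = {v, w}" "w \<in> T"
      "\<And>e' w'. e' \<in> edges G \<Longrightarrow> ends G e' = {v, w'} \<Longrightarrow> w' \<in> T \<Longrightarrow> e' = e"
  | v w where "ends G e = {v, w}" "v \<notin> D" "w \<in> D"
      "\<And>e' w'. e' \<in> edges G \<Longrightarrow> ends G e' = {v, w'} \<Longrightarrow> w' \<in> D \<Longrightarrow> e' = e"
proof (rule ccontr)
  assume contr: "\<not> thesis"
  note first = that(1) and second = that(2)
  let ?F = "G\<lparr>edges := edges G - {e}\<rparr>"
  have "nbrs ?F v \<inter> T \<noteq> {}" if v: "v \<in> verts G" for v
  proof -
    obtain e0 w where e0: "e0 \<in> edges G" "ends G e0 = {v, w}" "w \<in> T" by (rule ex_T_edge[OF v])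
    \<comment> \<open>Either \<open>e0\<close> already differs from \<open>e\<close>, or
      \<open>e0 = e\<close> and the failure of the first alternative supplies another edge.\<close>
    obtain e1 w1 where "e1 \<in> edges G" "ends G e1 = {v, w1}" "w1 \<in> T" "e1 \<noteq> e"
      using first[of v w] e0 contr by metis
    then show ?thesis using TV by (fastforce simp: nbrs_def adjacent_def)
  qed
  moreover have "nbrs ?F v \<inter> D \<noteq> {}" if v: "v \<in> verts G" "v \<notin> D" for v
  proof -
    obtain e0 w where e0: "e0 \<in> edges G" "ends G e0 = {v, w}" "w \<in> D" by (rule ex_D_edge[OF v])
    obtain e1 w1 where "e1 \<in> edges G" "ends G e1 = {v, w1}" "w1 \<in> D" "e1 \<noteq> e"
      using second[of v w] v e0 contr by metis
    then show ?thesis using DV by (fastforce simp: nbrs_def adjacent_def)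
  qed
  ultimately have "DT_pair ?F D T"
    using disjoint DV TV by (simp add: DT_pair_def dominating_def total_dominating_def)
  then show False using not_DT_pair_delete[OF e] by blast
qed

text \<open>An edge inside \<open>D\<close> has no end in \<open>T\<close> and no end outside
  \<open>D\<close>, so it fits neither alternative of \<open>edge_critical\<close>. Maximality is
  domination: a vertex outside \<open>D\<close> has a neighbour in \<open>D\<close> and cannot be
  added.\<close>

lemma maximal_independent: "maximal_independent G D"
proof -
  have "independent G D"
    unfolding independent_def
  proof (intro conjI ballI notI DV)
    fix u v assume uv: "u \<in> D" "v \<in> D" "v \<in> nbrs G u"
    then obtain e where e: "e \<in> edges G" "ends G e = {u, v}" by (auto simp: nbrs_def adjacent_def)
    from e(1) show False
      by (rule edge_critical) (use uv e(2) disjoint in \<open>auto simp: doubleton_eq_iff\<close>)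
  qed
  moreover have "S = D" if S: "independent G S" "D \<subseteq> S" for S
  proof (rule ccontr)
    assume "S \<noteq> D"
    then obtain v where v: "v \<in> S" "v \<notin> D" using S by blast
    then have "nbrs G v \<inter> D \<noteq> {}"
      using S(1) DT by (auto simp: independent_def DT_pair_def dominating_def)
    then show False using S v by (auto simp: independent_def)
  qed
  ultimately show ?thesis by (auto simp: maximal_independent_def)
qed

text \<open>Enlarging \<open>D\<close> to the complement of \<open>T\<close> preserves the DT-pair, so maximality of \<open>D\<close> applies.\<close>

lemma D_eq: "D = verts G - T"
proof -
  have "minimal_DT G (verts G - T) T"
  proof (unfold_locales, rule multigraph, rule minimal)
    have "nbrs G v \<inter> (verts G - T) \<noteq> {}" if v: "v \<in> T" for v
    proof -
      have "nbrs G v \<inter> D \<noteq> {}"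
        using DT v TV disjoint by (auto simp: DT_pair_def dominating_def)
      then show ?thesis using DV disjoint by blast
    qed
    then show "DT_pair G (verts G - T) T"
      using DT by (auto simp: DT_pair_def dominating_def)
  qed
  then have "independent G (verts G - T)"
    using minimal_DT.maximal_independent maximal_independent_def by blast
  then show ?thesis
    using maximal_independent disjoint DV unfolding maximal_independent_def by blast
qed

lemma in_T_iff: "v \<in> verts G \<Longrightarrow> v \<in> T \<longleftrightarrow> v \<notin> D"
  using D_eq disjoint by auto

lemma edge_cases:
  assumes e: "e \<in> edges G"
  obtains (inner) u v where "ends G e = {u, v}" "u \<in> T" "v \<in> T"
  | (cross) x d where "ends G e = {x, d}" "x \<in> T" "d \<in> D"
proof -
  obtain u v where uv: "ends G e = {u, v}" "u \<in> verts G" "v \<in> verts G"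
    by (rule multigraph_ends[OF multigraph e])
  have "\<not> (u \<in> D \<and> v \<in> D)"
    using maximal_independent e uv
    by (auto simp: maximal_independent_def independent_def nbrs_def adjacent_def)
  then show thesis
    using uv in_T_iff inner cross by (metis insert_commute)
qed

text \<open>An edge without an end in \<open>D\<close> can only be critical by the first alternative
  of \<open>edge_critical\<close>, and any edge inside \<open>T\<close> through \<open>v\<close>
  competes with it.\<close>

lemma inner_pendant:
  assumes "e \<in> edges G" "ends G e \<subseteq> T"
  obtains v w where "ends G e = {v, w}"
    "\<And>e'. e' \<in> edges G \<Longrightarrow> ends G e' \<subseteq> T \<Longrightarrow> v \<in> ends G e' \<Longrightarrow> e' = e"
  using assms(1)
proof (rule edge_critical)
  fix v w assume vw: "ends G e = {v, w}" "w \<in> T"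
    and u: "\<And>e' w'. e' \<in> edges G \<Longrightarrow> ends G e' = {v, w'} \<Longrightarrow> w' \<in> T \<Longrightarrow> e' = e"
  have "e' = e" if e': "e' \<in> edges G" "ends G e' \<subseteq> T" "v \<in> ends G e'" for e'
  proof -
    obtain a b where "ends G e' = {a, b}" using multigraph_ends[OF multigraph e'(1)] by metis
    then show ?thesis using u[OF e'(1)] e'(2,3) by (metis insert_commute insert_iff singletonD insert_subset)
  qed
  then show thesis using vw that by blast
next
  fix v w assume "ends G e = {v, w}" "w \<in> D"
  then show thesis using assms(2) disjoint by blast
qed

text \<open>If the edge is critical for reaching \<open>T\<close>, the vertex concerned is
  \<open>d\<close>. All edges at \<open>d\<close> lead to \<open>T\<close> because \<open>D\<close>
  is independent, so it is the only edge at \<open>d\<close> at all. Otherwise it is critical for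
  \<open>x\<close> reaching \<open>D\<close>.\<close>

lemma cross_pendant:
  assumes "e \<in> edges G" "ends G e = {x, d}" "x \<in> T" "d \<in> D"
  shows "(\<forall>e' w. e' \<in> edges G \<and> ends G e' = {x, w} \<and> w \<in> D \<longrightarrow> e' = e)
       \<or> (\<forall>e' \<in> edges G. d \<in> ends G e' \<longrightarrow> e' = e)"
  using assms(1)
proof (rule edge_critical)
  fix v w assume vw: "ends G e = {v, w}" "w \<in> T"
    and u: "\<And>e' w'. e' \<in> edges G \<Longrightarrow> ends G e' = {v, w'} \<Longrightarrow> w' \<in> T \<Longrightarrow> e' = e"
  have v: "v = d" using vw assms(2-4) disjoint by (auto simp: doubleton_eq_iff)
  have "e' = e" if e': "e' \<in> edges G" "d \<in> ends G e'" for e'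
  proof -
    from e'(1) obtain w' where "w' \<in> T" "ends G e' = {d, w'}"
      by (rule edge_cases) (use e'(2) assms(4) disjoint in auto)
    then show ?thesis using u e'(1) v by blast
  qed
  then show ?thesis by blast
next
  fix v w assume vw: "ends G e = {v, w}" "v \<notin> D" "w \<in> D"
    and u: "\<And>e' w'. e' \<in> edges G \<Longrightarrow> ends G e' = {v, w'} \<Longrightarrow> w' \<in> D \<Longrightarrow> e' = e"
  have "v = x"
    using vw assms(2-4) disjoint by (auto simp: doubleton_eq_iff)
  then show ?thesis using u by blast
qed

lemma cross_parallel:
  assumes "e \<in> edges G" "e' \<in> edges G" "ends G e = {x, d}" "ends G e' = {x, d}" "x \<in> T" "d \<in> D"
  shows "e' = e"
  using cross_pendant[OF assms(1,3,5,6)] assms(2,4,6) by blast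

lemma D_nbrs_or:
  assumes e: "e \<in> edges G" "ends G e = {x, d}" and "x \<in> T" "d \<in> D"
  shows "nbrs G x - T = {d} \<or> {e' \<in> edges G. d \<in> ends G e'} = {e}"
  using cross_pendant[OF e assms(3,4)]
proof
  assume u: "\<forall>e' w. e' \<in> edges G \<and> ends G e' = {x, w} \<and> w \<in> D \<longrightarrow> e' = e"
  have "w = d" if w: "w \<in> nbrs G x" "w \<notin> T" for w
  proof -
    obtain e' where e': "e' \<in> edges G" "ends G e' = {x, w}"
      using w by (auto simp: nbrs_def adjacent_def)
    have "w \<in> D" using w D_eq by (auto simp: nbrs_def)
    with u e' have "e' = e" by blast
    then show ?thesis using e(2) e'(2) by (auto simp: doubleton_eq_iff)
  qed
  moreover have "d \<in> nbrs G x - T"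
    using assms DV disjoint by (auto simp: nbrs_def adjacent_def)
  ultimately show ?thesis by blast
qed (use e(1,2) in blast)

lemma D_nbrs_leaves:
  assumes "x \<in> T" "d \<in> nbrs G x - T"
  shows "nbrs G x - T = {d} \<or> d \<in> leaves G"
proof -
  obtain e where e: "e \<in> edges G" "ends G e = {x, d}"
    using assms(2) by (auto simp: nbrs_def adjacent_def)
  have d: "d \<in> D" "x \<noteq> d" using assms D_eq by (auto simp: nbrs_def)
  then have "\<not> is_loop G e" using e(2) by (simp add: is_loop_def)
  have "d \<in> leaves G" if "{e' \<in> edges G. d \<in> ends G e'} = {e}"
    using that \<open>\<not> is_loop G e\<close> d(1) DV by (auto simp only: leaves_iff[OF finite_edges])
  with D_nbrs_or[OF e assms(1) d(1)] show ?thesis by blast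
qed

lemma D_nbrs_cases:
  assumes "x \<in> T"
  shows "nbrs G x - T \<noteq> {}"
    and "card (nbrs G x - T) = 1 \<or> nbrs G x - T \<subseteq> leaves G"
proof -
  have x: "x \<in> verts G" "x \<notin> D" using assms TV disjoint by auto
  have "nbrs G x \<inter> D \<noteq> {}"
    using x DT by (auto simp: DT_pair_def dominating_def)
  then show "nbrs G x - T \<noteq> {}" using disjoint by blast
  show "card (nbrs G x - T) = 1 \<or> nbrs G x - T \<subseteq> leaves G"
    using D_nbrs_leaves[OF assms] by (metis is_singletonI is_singleton_altdef subsetI)
qed

subsection \<open>The graph induced by \<open>T\<close>\<close>

abbreviation K where "K \<equiv> induced G T"

lemma multigraph_K: "multigraph K"
  by (rule multigraph_induced[OF multigraph TV])

lemma K_simps: "verts K = T" "e \<in> edges K \<longleftrightarrow> e \<in> edges G \<and> ends G e \<subseteq> T" "ends K = ends G"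
  by (auto simp: induced_def)

lemma ex_K_edge:
  assumes "x \<in> T"
  obtains e where "e \<in> edges K" "x \<in> ends G e"
proof -
  obtain e w where "e \<in> edges G" "ends G e = {x, w}" "w \<in> T"
    by (rule ex_T_edge[of x]) (use assms TV in auto)
  then show thesis using that[of e] assms by (simp add: K_simps)
qed

definition pendant :: "'v \<Rightarrow> 'e \<Rightarrow> bool" where
  "pendant v e \<longleftrightarrow> v \<in> ends G e \<and> (\<forall>e'\<in>edges K. v \<in> ends G e' \<longrightarrow> e' = e)"

lemma pendantD: "pendant v e \<Longrightarrow> e' \<in> edges K \<Longrightarrow> v \<in> ends G e' \<Longrightarrow> e' = e"
  by (auto simp: pendant_def)

lemma K_edge_pendant:
  assumes e: "e \<in> edges K"
  obtains v w where "ends G e = {v, w}" "pendant v e"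
proof -
  have "e \<in> edges G" "ends G e \<subseteq> T" using e by (auto simp: K_simps)
  then show thesis
    by (rule inner_pendant) (use that in \<open>simp add: K_simps pendant_def\<close>)
qed

text \<open>Some edge \<open>e\<close> of the component has a pendant end \<open>v\<close>. If
  \<open>e\<close> is a loop, nothing else can be reached from \<open>v\<close>. Otherwise the other
  end \<open>w\<close> is the centre, and the edges at \<open>w\<close> make up the whole
  component.\<close>

lemma component_star_or_loop:
  assumes C: "C \<in> components K"
  shows "is_star C \<or> is_one_vertex_one_loop C"
proof -
  note C_simps = component_simps[OF C, unfolded K_simps]
  note C_edge = component_edge[OF multigraph_K C, unfolded K_simps(3)]
  obtain v0 where "v0 \<in> verts C" using C_simps by auto
  then have "v0 \<in> T" using C_simps(3) by auto
  then obtain e where e: "e \<in> edges K" "v0 \<in> ends G e" by (rule ex_K_edge)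
  have eC: "e \<in> edges C" by (rule C_edge) fact+
  obtain v w where vw: "ends G e = {v, w}" "pendant v e" by (rule K_edge_pendant[OF e(1)])
  have vwC: "v \<in> verts C" "w \<in> verts C" using eC vw(1) by (auto simp: C_simps)
  show ?thesis
  proof (cases "v = w")
    case True
    have "verts C \<subseteq> {v}"
    proof (rule component_subset[OF C vwC(1)])
      fix a b assume "a \<in> {v}" "adjacent K a b"
      then obtain e' where "e' \<in> edges K" "ends G e' = {v, b}" by (auto simp: adjacent_def K_simps)
      then show "b \<in> {v}" using pendantD[OF vw(2), of e'] vw(1) True by auto
    qed simp
    then have V: "verts C = {v}" using vwC by auto
    have "e' = e" if "e' \<in> edges C" for e'
    proof -
      have e': "e' \<in> edges K" "ends G e' \<subseteq> {v}" using that by (auto simp: C_simps V K_simps)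
      moreover obtain a b where "ends K e' = {a, b}" using multigraph_ends[OF multigraph_K e'(1)] .
      ultimately have "v \<in> ends G e'" by (simp add: K_simps)
      then show ?thesis using pendantD[OF vw(2) e'(1)] by simp
    qed
    then have "edges C = {e}" using eC by blast
    then show ?thesis using V vw(1) True by (auto simp: is_one_vertex_one_loop_def C_simps)
  next
    case False
    define E where "E = {e' \<in> edges K. w \<in> ends G e'}"
    have eE: "e \<in> E" using e vw by (simp add: E_def)
    have "\<exists>u. ends G e' = {w, u} \<and> u \<noteq> w \<and> pendant u e'" if e': "e' \<in> E" for e'
    proof (cases "e' = e")
      case True
      then show ?thesis using vw False by (auto simp: insert_commute)
    next
      case neq: False
      have e'K: "e' \<in> edges K" "w \<in> ends G e'" using e' by (auto simp: E_def)
      obtain a b where ab: "ends G e' = {a, b}" "pendant a e'" by (rule K_edge_pendant[OF e'K(1)])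
      \<comment> \<open>Both \<open>e\<close> and \<open>e'\<close> contain \<open>w\<close>, so
        \<open>w\<close> is not the pendant end of \<open>e'\<close>; in particular
        \<open>e'\<close> is no loop.\<close>
      have "a \<noteq> w" using pendantD[OF ab(2) e(1)] vw(1) neq by auto
      then show ?thesis using ab e'K(2) by (auto simp: insert_commute)
    qed
    then obtain l where l: "\<And>e'. e' \<in> E \<Longrightarrow> ends G e' = {w, l e'} \<and> l e' \<noteq> w \<and> pendant (l e') e'"
      by metis
    have sub: "verts C \<subseteq> insert w (l ` E)"
    proof (rule component_subset[OF C vwC(2)])
      fix a b assume a: "a \<in> insert w (l ` E)" "adjacent K a b"
      then obtain e' where e': "e' \<in> edges K" "ends G e' = {a, b}" by (auto simp: adjacent_def K_simps)
      \<comment> \<open>A vertex \<open>l e''\<close> lies on no edge of \<open>K\<close> but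
        \<open>e''\<close>, so every edge meeting this set is an edge at \<open>w\<close>.\<close>
      from a(1) have "e' \<in> E"
      proof
        assume "a \<in> l ` E"
        then obtain e'' where "e'' \<in> E" "a = l e''" by auto
        then show ?thesis using pendantD[of "l e''" e'' e'] l e' by auto
      qed (use e' in \<open>auto simp: E_def\<close>)
      then show "b \<in> insert w (l ` E)" using l[of e'] e'(2) by (auto simp: doubleton_eq_iff)
    qed simp
    have EC: "E \<subseteq> edges C" using C_edge vwC(2) by (auto simp: E_def)
    have V: "verts C = insert w (l ` E)"
      using sub vwC(2) EC l by (fastforce simp: C_simps)
    have "edges C = E"
    proof (intro equalityI EC subsetI)
      fix e' assume "e' \<in> edges C"
      then have e': "e' \<in> edges K" "ends G e' \<subseteq> verts C" by (auto simp: C_simps K_simps)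
      obtain a b where ab: "ends G e' = {a, b}"
        using multigraph_ends[OF multigraph_K e'(1)] by (metis K_simps(3))
      then have "a = w \<or> a \<in> l ` E" using e'(2) V by auto
      then show "e' \<in> E"
      proof
        assume "a \<in> l ` E"
        then obtain e'' where "e'' \<in> E" "a = l e''" by auto
        then show ?thesis using pendantD[of "l e''" e'' e'] l e' ab by auto
      qed (use e' ab in \<open>auto simp: E_def\<close>)
    qed
    moreover have "inj_on l E"
    proof (rule inj_onI)
      fix e1 e2 assume "e1 \<in> E" "e2 \<in> E" "l e1 = l e2"
      then show "e1 = e2" using pendantD[of "l e2" e2 e1] l[of e1] l[of e2] by (simp add: E_def)
    qed
    moreover have "finite E"
      using finite_edges by (simp add: E_def K_simps)
    ultimately have "is_star C"
      using eE l V by (intro is_starI[where c = w and l = l]) (auto simp: C_simps)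
    then show ?thesis ..
  qed
qed

text \<open>If \<open>x\<close> had a \<open>D\<close>-neighbour that is not a leaf, moving \<open>x\<close> from \<open>T\<close> to \<open>D\<close> would give
  a DT-pair that does not use the edge from \<open>x\<close> to that neighbour.\<close>

lemma star_leaf_nbrs:
  assumes C: "C \<in> components K" and x: "x \<in> leaves C" and card: "card (verts C) \<ge> 3"
  shows "nbrs G x - T \<subseteq> leaves G"
proof (rule ccontr)
  assume "\<not> nbrs G x - T \<subseteq> leaves G"
  then obtain d where d: "d \<in> nbrs G x - T" "d \<notin> leaves G" by blast
  note C_simps = component_simps[OF C, unfolded K_simps]
  note C_edge = component_edge[OF multigraph_K C, unfolded K_simps(3)]
  have xC: "x \<in> verts C" using x by (simp add: leaves_def)
  then have xT: "x \<in> T" using C_simps by auto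
  obtain e where e: "e \<in> edges K" "x \<in> ends G e" by (rule ex_K_edge[OF xT])
  have "finite (edges C)" using finite_edges by (simp add: C_simps K_simps)
  then obtain e0 where e0: "{e \<in> edges C. x \<in> ends G e} = {e0}" "\<not> is_loop C e0"
    using x by (auto simp only: leaves_iff C_simps(2))
  have mem: "e' \<in> {e \<in> edges C. x \<in> ends G e}" if "e' \<in> edges K" "x \<in> ends G e'" for e'
    using C_edge[OF that xC] that(2) by simp
  have uniq: "e' = e" if "e' \<in> edges K" "x \<in> ends G e'" for e'
    using mem[OF that] mem[OF e] unfolding e0 by simp
  have eC: "e \<in> edges C" using mem[OF e] by simp
  have noloop: "\<not> is_loop C e" using mem[OF e] e0(2) unfolding e0 by simp
  obtain y where y: "ends G e = {x, y}"
    using ends_eqI[OF multigraph_K e(1)] e(2) by (metis K_simps(3))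
  have xy: "x \<noteq> y" using noloop y by (auto simp: is_loop_def C_simps)
  have yC: "y \<in> verts C" using eC y by (auto simp: C_simps)
  have yT: "y \<in> T" using yC C_simps by auto
  have x_only: "t = y" if t: "adjacent G x t" "t \<in> T" for t
  proof -
    obtain e' where e': "e' \<in> edges G" "ends G e' = {x, t}" using t by (auto simp: adjacent_def)
    then have "e' = e" using t xT by (intro uniq) (auto simp: K_simps)
    then show ?thesis using e' y by (auto simp: doubleton_eq_iff)
  qed
  \<comment> \<open>Here the order of the star enters: without such a \<open>z\<close> the set
    \<open>{x, y}\<close> would be closed under adjacency in \<open>K\<close>.\<close>
  obtain z where z: "z \<in> T" "z \<noteq> x" "adjacent G y z"
  proof (rule ccontr)
    note z_that = that
    assume no: "\<not> thesis"
    have "verts C \<subseteq> {x, y}"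
    proof (rule component_subset[OF C xC])
      fix a b assume ab: "a \<in> {x, y}" "adjacent K a b"
      then have "adjacent G a b" "b \<in> T" by (auto simp: adjacent_def K_simps)
      then show "b \<in> {x, y}" using ab x_only no z_that by blast
    qed simp
    then have "card (verts C) \<le> card {x, y}" by (intro card_mono) auto
    also have "\<dots> \<le> 2" by (simp add: card_insert_if)
    finally show False using card by simp
  qed
  have dD: "d \<in> D" using d D_eq by (auto simp: nbrs_def)
  have dnbr: "nbrs G x - T = {d}" using D_nbrs_leaves[OF xT d(1)] d(2) by blast
  obtain f where f: "f \<in> edges G" "ends G f = {x, d}" using d(1) by (auto simp: nbrs_def adjacent_def)
  \<comment> \<open>All edges at \<open>d\<close> lead to \<open>T\<close> and only \<open>f\<close>
    joins \<open>d\<close> to \<open>x\<close>; since \<open>d\<close> is not a leaf, another edge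
    leads elsewhere in \<open>T\<close>.\<close>
  obtain t where t: "t \<in> T" "t \<noteq> x" "adjacent G d t"
  proof (rule ccontr)
    note t_that = that
    assume no: "\<not> thesis"
    have "e' = f" if e': "e' \<in> edges G" "d \<in> ends G e'" for e'
    proof -
      from e'(1) obtain w where w: "w \<in> T" "ends G e' = {d, w}"
        by (rule edge_cases) (use e'(2) dD disjoint in auto)
      then have "w = x" using no t_that w e' by (auto simp: adjacent_def)
      then show ?thesis using w(2) f cross_parallel[OF f(1) e'(1) f(2) _ xT dD] by (simp add: insert_commute)
    qed
    then have eq: "{e' \<in> edges G. d \<in> ends G e'} = {f}" using f by blast
    have "x \<noteq> d" using dD xT disjoint by auto
    then have "\<not> is_loop G f" by (simp add: is_loop_def f)
    then have "d \<in> leaves G"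
      using eq dD DV by (auto simp only: leaves_iff[OF finite_edges])
    then show False using d(2) by blast
  qed
  let ?F = "G\<lparr>edges := edges G - {f}\<rparr>"
  have keep: "adjacent ?F a b" if ab: "adjacent G a b" "{a, b} \<noteq> {x, d}" for a b
  proof -
    obtain e' where "e' \<in> edges G" "ends G e' = {a, b}" using ab(1) by (auto simp: adjacent_def)
    moreover have "e' \<noteq> f" using calculation f(2) ab(2) by auto
    ultimately show ?thesis by (auto simp: adjacent_def)
  qed
  \<comment> \<open>The vertices \<open>y\<close>, \<open>d\<close> and \<open>x\<close> have the
    neighbours \<open>z\<close>, \<open>t\<close> and \<open>y\<close> in \<open>T - {x}\<close>.
    Any other vertex is not adjacent to \<open>x\<close>, so its neighbour in \<open>T\<close>
    survives.\<close>
  have T_nbr: "\<exists>u\<in>T - {x}. adjacent G v u" if v: "v \<in> verts G" for v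
  proof -
    consider "v = y" | "v = d" | "v = x" | "v \<notin> {y, d, x}" by auto
    then show ?thesis
    proof cases
      case 3
      have "adjacent G x y" using e(1) y by (auto simp: adjacent_def K_simps)
      then show ?thesis using 3 yT xy by auto
    next
      case 4
      obtain u where u: "u \<in> T" "adjacent G v u"
        by (rule ex_T_edge[OF v]) (auto simp: adjacent_def)
      have "u \<noteq> x"
      proof
        assume "u = x"
        then have xv: "adjacent G x v" using u by (simp add: adjacent_sym)
        show False
        proof (cases "v \<in> T")
          case False
          then have "v \<in> nbrs G x - T" using xv v by (simp add: nbrs_def)
          then show False using dnbr 4 by auto
        qed (use x_only xv 4 in auto)
      qed
      then show ?thesis using u by auto
    qed (use z t in auto)
  qed
  have "nbrs ?F v \<inter> (T - {x}) \<noteq> {}" if v: "v \<in> verts G" for v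
  proof -
    obtain u where u: "u \<in> T - {x}" "adjacent G v u" using T_nbr[OF v] by blast
    have "{v, u} \<noteq> {x, d}" using u(1) dD disjoint by (auto simp: doubleton_eq_iff)
    from keep[OF u(2) this] show ?thesis using u TV by (auto simp: nbrs_def)
  qed
  then have td: "total_dominating ?F (T - {x})"
    using TV by (auto simp: total_dominating_def)
  have "nbrs ?F v \<inter> insert x D \<noteq> {}" if v: "v \<in> verts G - insert x D" for v
  proof -
    obtain u where u: "u \<in> D" "adjacent G v u"
      by (rule ex_D_edge[of v]) (use v in \<open>auto simp: adjacent_def\<close>)
    have "{v, u} \<noteq> {x, d}" using v dD by (auto simp: doubleton_eq_iff)
    from keep[OF u(2) this] show ?thesis using u DV by (auto simp: nbrs_def)
  qed
  then have "dominating ?F (insert x D)"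
    using DV xT TV by (auto simp: dominating_def)
  moreover have "insert x D \<inter> (T - {x}) = {}" using disjoint by auto
  ultimately have "DT_pair ?F (insert x D) (T - {x})" using td by (simp add: DT_pair_def)
  then show False using not_DT_pair_delete[OF f(1)] by blast
qed

subsection \<open>The 2-subdivision structure\<close>

definition N where "N x = nbrs G x - T"

lemma N_iff: "x \<in> T \<Longrightarrow> d \<in> N x \<longleftrightarrow> d \<in> D \<and> adjacent G x d"
  using D_eq by (auto simp: N_def nbrs_def)

lemma finite_N: "finite (N x)"
  by (rule finite_subset[OF _ finite_verts]) (auto simp: N_def nbrs_def)

text \<open>Two edges meet at \<open>d\<close>, which rules out the second alternative of
  \<open>D_nbrs_or\<close>. By symmetry \<open>N y\<close> is the same singleton, so two sets
  \<open>N x\<close> and \<open>N y\<close> are equal or disjoint.\<close>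

lemma N_eq_singleton:
  assumes "x \<in> T" "y \<in> T" "x \<noteq> y" "d \<in> N x" "d \<in> N y"
  shows "N x = {d}"
proof -
  have d: "d \<in> D" using assms N_iff by blast
  obtain e where e: "e \<in> edges G" "ends G e = {x, d}"
    using assms(1,4) by (auto simp: N_iff adjacent_def)
  obtain e' where e': "e' \<in> edges G" "ends G e' = {y, d}"
    using assms(2,5) by (auto simp: N_iff adjacent_def)
  have "ends G e \<noteq> ends G e'" using e e' assms(1-3) d disjoint by (auto simp: doubleton_eq_iff)
  moreover have "e' \<in> {e' \<in> edges G. d \<in> ends G e'}" using e' by simp
  ultimately have "{e' \<in> edges G. d \<in> ends G e'} \<noteq> {e}" by (metis singletonD)
  then show ?thesis using D_nbrs_or[OF e assms(1) d] by (simp add: N_def)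
qed

text \<open>Hence the sets \<open>N x\<close> with \<open>x \<in> T\<close> form a partition of \<open>D\<close>. The vertices of \<open>H\<close> are
  representatives of its blocks: a block with several elements consists of the leaves attached
  to a single \<open>x\<close>, and is recovered as the copies of one leaf.\<close>

definition rep :: "'v \<Rightarrow> 'v" where
  "rep x = (SOME d. d \<in> N x)"

text \<open>The choice is harmless: all candidates have the same set \<open>N\<close>, and only this
  set is used.\<close>

definition anchor :: "'v \<Rightarrow> 'v" where
  "anchor d = (SOME x. x \<in> T \<and> d \<in> N x)"

text \<open>The enumeration is chosen from the set \<open>N (anchor d)\<close> alone, so all
  elements of one block of \<open>D\<close> are numbered by the same bijection.\<close>

definition index :: "'v \<Rightarrow> nat" where
  "index d = (SOME h. bij_betw h (N (anchor d)) {0..<card (N (anchor d))}) d"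

lemma N_nonempty: "x \<in> T \<Longrightarrow> N x \<noteq> {}"
  unfolding N_def by (rule D_nbrs_cases(1))

lemma rep_in: "x \<in> T \<Longrightarrow> rep x \<in> N x"
  by (simp add: rep_def some_in_eq N_nonempty)

lemma anchor:
  assumes "d \<in> D"
  shows "anchor d \<in> T" "d \<in> N (anchor d)"
proof -
  obtain e x where "e \<in> edges G" "ends G e = {d, x}" "x \<in> T"
    by (rule ex_T_edge[of d]) (use assms DV in auto)
  then have "x \<in> T \<and> d \<in> N x"
    using assms by (auto simp: N_iff adjacent_def insert_commute)
  then have "anchor d \<in> T \<and> d \<in> N (anchor d)" unfolding anchor_def by (rule someI)
  then show "anchor d \<in> T" "d \<in> N (anchor d)" by auto
qed

lemma N_anchor_eq:
  assumes "x \<in> T" "d \<in> N x"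
  shows "N (anchor d) = N x"
proof -
  have "d \<in> D" using assms N_iff by blast
  note anchor[OF this]
  then show ?thesis using N_eq_singleton assms by (metis (no_types, lifting))
qed

text \<open>The value \<open>rep x\<close> is chosen from the set \<open>N x\<close> alone, so equal
  sets have equal representatives.\<close>

lemma rep_anchor:
  assumes "x \<in> T" "d \<in> N x"
  shows "rep (anchor d) = rep x"
  unfolding rep_def N_anchor_eq[OF assms] ..

lemma N_rep: "x \<in> T \<Longrightarrow> N (anchor (rep x)) = N x"
  by (rule N_anchor_eq[OF _ rep_in])

lemma N_eqI: "x \<in> T \<Longrightarrow> y \<in> T \<Longrightarrow> rep x = rep y \<Longrightarrow> N x = N y"
  using N_rep by metis

lemma in_N_iff: "x \<in> T \<Longrightarrow> d \<in> D \<Longrightarrow> d \<in> N x \<longleftrightarrow> rep (anchor d) = rep x"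
  using rep_anchor N_eqI anchor by metis

lemma index_bij:
  assumes "x \<in> T"
  shows "bij_betw index (N x) {0..<card (N x)}"
proof -
  define h where "h = (SOME h. bij_betw h (N x) {0..<card (N x)})"
  have "bij_betw h (N x) {0..<card (N x)}"
    unfolding h_def by (rule someI_ex[OF ex_bij_betw_finite_nat[OF finite_N]])
  moreover have "index d = h d" if "d \<in> N x" for d
    unfolding index_def h_def N_anchor_eq[OF assms that] ..
  ultimately show ?thesis by (metis bij_betw_cong)
qed

section \<open>The graph \<open>H\<close> and the blocks of half-edges\<close>

definition end1 :: "'e \<Rightarrow> 'v" where
  "end1 e = (SOME x. x \<in> ends G e)"

text \<open>Completing the pair, instead of taking a different element, yields \<open>end1 e\<close>
  again when \<open>e\<close> is a loop.\<close>

definition end2 :: "'e \<Rightarrow> 'v" where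
  "end2 e = (SOME y. ends G e = {end1 e, y})"

lemma K_ends:
  assumes "e \<in> edges K"
  shows "ends G e = {end1 e, end2 e}" "end1 e \<in> T" "end2 e \<in> T"
proof -
  have e: "e \<in> edges G" "ends G e \<subseteq> T" using assms by (auto simp: K_simps)
  obtain u v where "ends G e = {u, v}" by (rule multigraph_ends[OF multigraph e(1)])
  then have "ends G e \<noteq> {}" by simp
  then have "end1 e \<in> ends G e" by (simp add: end1_def some_in_eq)
  from ends_eqI[OF multigraph e(1) this] obtain y where "ends G e = {end1 e, y}" .
  then show *: "ends G e = {end1 e, end2 e}" unfolding end2_def by (rule someI)
  show "end1 e \<in> T" "end2 e \<in> T" using e(2) unfolding * by auto
qed

text \<open>Representatives in place of sets keep the vertex type of \<open>G\<close>. An edge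
  joining two vertices of \<open>T\<close> with the same representative becomes a loop.\<close>

definition H :: "('v, 'e) mgraph" where
  "H = \<lparr>verts = rep ` T, edges = edges K, ends = (\<lambda>e. rep ` ends G e)\<rparr>"

text \<open>Together with \<open>half2\<close> this labels the two ends of \<open>e\<close> by the
  new vertices of \<open>S2 H\<close>. The case distinction is by representatives, since it is in
  \<open>H\<close> that \<open>e\<close> has to be a loop.\<close>

definition half1 :: "'e \<Rightarrow> ('v, 'e) s2_vertex" where
  "half1 e = (if rep (end1 e) = rep (end2 e) then LoopSub1 (rep (end1 e)) e else Sub (rep (end1 e)) e)"

definition half2 :: "'e \<Rightarrow> ('v, 'e) s2_vertex" where
  "half2 e = (if rep (end1 e) = rep (end2 e) then LoopSub2 (rep (end2 e)) e else Sub (rep (end2 e)) e)"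

text \<open>A loop of \<open>G\<close> has both halves in one block, whereas an edge between
  distinct vertices with equal representatives has them in different blocks. So loops of
  \<open>H\<close> keep the information whether they were loops of \<open>G\<close>.\<close>

definition block :: "'v \<Rightarrow> ('v, 'e) s2_vertex set" where
  "block x = {half1 e |e. e \<in> edges K \<and> end1 e = x} \<union> {half2 e |e. e \<in> edges K \<and> end2 e = x}"

definition P :: "'v \<Rightarrow> ('v, 'e) s2_vertex set set" where
  "P v = block ` {x \<in> T. rep x = v}"

lemma H_simps: "verts H = rep ` T" "edges H = edges K" "ends H e = rep ` ends G e"
  by (simp_all add: H_def)

lemma half_eq_iff:
  "half1 e = half1 e' \<longleftrightarrow> e = e'" "half2 e = half2 e' \<longleftrightarrow> e = e'"
  "half1 e \<noteq> half2 e'" "half2 e \<noteq> half1 e'"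
  by (auto simp: half1_def half2_def)

lemma owner_half: "owner (half1 e) = rep (end1 e)" "owner (half2 e) = rep (end2 e)"
  by (auto simp: half1_def half2_def)

lemma new_verts_H: "e \<in> edges K \<Longrightarrow> new_verts H e = {half1 e, half2 e}"
  by (auto simp: new_verts_def is_loop_def H_simps K_ends half1_def half2_def card_insert_if)

lemma block_disjoint: "h \<in> block x \<Longrightarrow> h \<in> block y \<Longrightarrow> x = y"
  by (auto simp: block_def half_eq_iff)

lemma block_new_verts: "e \<in> edges K \<Longrightarrow> block x \<inter> new_verts H e \<noteq> {} \<longleftrightarrow> x \<in> ends G e"
  by (auto simp: block_def new_verts_H half_eq_iff K_ends)

text \<open>Total domination gives \<open>x\<close> an edge inside \<open>T\<close>. Nonempty
  disjoint blocks are distinct, so a block determines its vertex.\<close>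

lemma block_nonempty:
  assumes "x \<in> T"
  shows "block x \<noteq> {}"
proof -
  obtain e where "e \<in> edges K" "x \<in> ends G e" by (rule ex_K_edge[OF assms])
  then show ?thesis using block_new_verts by blast
qed

lemma block_eq_iff: "x \<in> T \<Longrightarrow> block x = block y \<longleftrightarrow> x = y"
  using block_nonempty block_disjoint by blast

lemma owner_block: "h \<in> block x \<Longrightarrow> owner h = rep x"
  by (auto simp: block_def owner_half)

lemma new_verts_block: "(\<Union>e\<in>edges H. new_verts H e) = (\<Union>x\<in>T. block x)"
proof -
  have "(\<Union>e\<in>edges H. new_verts H e) = (\<Union>e\<in>edges K. {half1 e, half2 e})"
    by (simp add: H_simps new_verts_H)
  also have "\<dots> = (\<Union>x\<in>T. block x)"
  proof
    have "half1 e \<in> block (end1 e)" "half2 e \<in> block (end2 e)" if "e \<in> edges K" for e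
      using that by (auto simp: block_def)
    then show "(\<Union>e\<in>edges K. {half1 e, half2 e}) \<subseteq> (\<Union>x\<in>T. block x)"
      using K_ends(2,3) by blast
  qed (auto simp: block_def)
  finally show ?thesis .
qed

lemma finite_T: "finite T" and finite_K_edges: "finite (edges K)"
  using multigraph_K by (auto simp: multigraph_def K_simps)

lemma multigraph_H: "multigraph H"
proof -
  have "rep ` ends G e \<subseteq> rep ` T" if "e \<in> edges K" for e
    using that by (auto simp: K_simps)
  moreover have "card (rep ` ends G e) = 1 \<or> card (rep ` ends G e) = 2" if "e \<in> edges K" for e
    by (simp add: K_ends(1)[OF that] card_insert_if)
  ultimately show ?thesis
    using finite_T finite_K_edges by (simp add: multigraph_def H_simps)
qed

text \<open>The contraction \<open>p\<close> sends each edge of \<open>G\<close> to a single vertex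
  or to an edge of \<open>H\<close>, so walks of \<open>G\<close> project to walks of
  \<open>H\<close>.\<close>

lemma gconnected_H: "gconnected H"
proof -
  define p where "p u = (if u \<in> T then rep u else rep (anchor u))" for u
  have conn: "gconnected G" using minimal by (simp add: minimal_DTDP_def)
  have step: "p u = p v \<or> adjacent H (p u) (p v)" if uv: "adjacent G u v" for u v
  proof -
    obtain e where e: "e \<in> edges G" "ends G e = {u, v}" using uv by (auto simp: adjacent_def)
    from e(1) show ?thesis
    proof (cases rule: edge_cases)
      case (inner a b)
      then have "u \<in> T" "v \<in> T" using e by (auto simp: doubleton_eq_iff)
      then show ?thesis using e by (auto simp: p_def adjacent_def H_simps K_simps intro!: bexI[of _ e])
    next
      case (cross x d)
      then have "d \<in> N x" using e by (auto simp: N_iff adjacent_def)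
      then have "rep (anchor d) = rep x" using rep_anchor cross(2) by blast
      then have "p d = p x" using cross disjoint by (auto simp: p_def)
      then show ?thesis using e(2) cross(1) by (auto simp: doubleton_eq_iff)
    qed
  qed
  have path: "(adjacent H)\<^sup>*\<^sup>* (p u) (p v)" if "(adjacent G)\<^sup>*\<^sup>* u v" for u v
    using that
  proof induction
    case (step v w)
    then show ?case using \<open>\<And>u v. adjacent G u v \<Longrightarrow> p u = p v \<or> adjacent H (p u) (p v)\<close>
      by (metis rtranclp.rtrancl_into_rtrancl)
  qed simp
  have "T \<noteq> {}"
    using conn DT by (auto simp: gconnected_def DT_pair_def total_dominating_def)
  moreover have "(adjacent H)\<^sup>*\<^sup>* (rep x) (rep y)" if "x \<in> T" "y \<in> T" for x y
    using path[of x y] conn that TV by (auto simp: gconnected_def p_def)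
  ultimately show ?thesis by (auto simp: gconnected_def H_simps)
qed

lemma nbrs_S2_Orig: "nbrs (S2 H) (Orig v) = (\<Union>x\<in>{x \<in> T. rep x = v}. block x)"
proof -
  have not_Orig: "h \<noteq> Orig w" if "h \<in> block x" for h w x
    using that by (auto simp: block_def half1_def half2_def split: if_splits)
  have "adjacent (S2 H) (Orig v) u \<longleftrightarrow> (\<exists>x\<in>T. u \<in> block x \<and> rep x = v)" for u
  proof
    assume "adjacent (S2 H) (Orig v) u"
    then obtain a where a: "a \<in> edges (S2 H)" "ends (S2 H) a = {Orig v, u}"
      by (auto simp: adjacent_def)
    show "\<exists>x\<in>T. u \<in> block x \<and> rep x = v"
    proof (cases a)
      case (Link h)
      then obtain x where x: "x \<in> T" "h \<in> block x"
        using a(1) by (auto simp: S2_def new_verts_block)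
      have "{Orig (owner h), h} = {Orig v, u}" using a(2) Link by (simp add: S2_def)
      then have "u = h" "owner h = v" using not_Orig[OF x(2)] by (auto simp: doubleton_eq_iff)
      then show ?thesis using x owner_block[OF x(2)] by auto
    next
      case (Mid e)
      then have "e \<in> edges K" "Orig v \<in> new_verts H e"
        using a by (auto simp: S2_def H_simps)
      then show ?thesis by (auto simp: new_verts_H half1_def half2_def split: if_splits)
    qed
  next
    assume "\<exists>x\<in>T. u \<in> block x \<and> rep x = v"
    then obtain x where x: "x \<in> T" "u \<in> block x" "rep x = v" by blast
    then have "Link u \<in> edges (S2 H)" by (auto simp: S2_def new_verts_block)
    moreover have "ends (S2 H) (Link u) = {Orig v, u}"
      using owner_block[OF x(2)] x(3) by (simp add: S2_def)
    ultimately show "adjacent (S2 H) (Orig v) u" by (auto simp: adjacent_def)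
  qed
  then show ?thesis by (auto simp: nbrs_def S2_def new_verts_block)
qed

lemma S2_family_P: "S2_family H P"
  unfolding S2_family_def
proof
  fix v
  have "disjoint (P v)"
    using block_disjoint unfolding P_def disjoint_def by blast
  moreover have "{} \<notin> P v" using block_nonempty by (auto simp: P_def)
  ultimately show "partition_on (nbrs (S2 H) (Orig v)) (P v)"
    by (simp add: partition_on_def nbrs_S2_Orig P_def)
qed

section \<open>The graph \<open>S2PT H P mult\<close>\<close>

definition mult :: "('v, 'e) s2p_vertex \<Rightarrow> nat" where
  "mult b = (case b of Base v \<Rightarrow> card (N (anchor v)) | Block v A \<Rightarrow> 1)"

lemma P_iff: "v \<in> rep ` T \<and> A \<in> P v \<longleftrightarrow> (\<exists>x\<in>T. v = rep x \<and> A = block x)"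
proof
  assume "v \<in> rep ` T \<and> A \<in> P v"
  then obtain x where "x \<in> T" "rep x = v" "A = block x" by (auto simp: P_def)
  then show "\<exists>x\<in>T. v = rep x \<and> A = block x" by auto
qed (auto simp: P_def)

lemma S2P_verts: "verts (S2P H P) = Base ` rep ` T \<union> (\<lambda>x. Block (rep x) (block x)) ` T"
  by (simp add: S2P_def H_simps P_iff) blast

lemma S2P_edges: "edges (S2P H P) = (\<lambda>x. Spoke (rep x) (block x)) ` T \<union> Across ` edges K"
  by (simp add: S2P_def H_simps P_iff) blast

lemma S2P_ends_Spoke: "ends (S2P H P) (Spoke v A) = {Base v, Block v A}"
  by (simp add: S2P_def)

lemma S2P_ends_Across:
  assumes "e \<in> edges K"
  shows "ends (S2P H P) (Across e) = (\<lambda>x. Block (rep x) (block x)) ` ends G e"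
proof -
  have "ends (S2P H P) (Across e) =
      {Block v A |v A. (v \<in> rep ` T \<and> A \<in> P v) \<and> A \<inter> new_verts H e \<noteq> {}}"
    by (simp add: S2P_def H_simps)
  also have "\<dots> = {Block (rep x) (block x) |x. x \<in> T \<and> block x \<inter> new_verts H e \<noteq> {}}"
    unfolding P_iff by blast
  also have "\<dots> = {Block (rep x) (block x) |x. x \<in> T \<and> x \<in> ends G e}"
    by (simp only: block_new_verts[OF assms])
  also have "\<dots> = (\<lambda>x. Block (rep x) (block x)) ` ends G e"
    using assms by (auto simp: K_simps)
  finally show ?thesis .
qed

lemma finite_S2P_edges: "finite (edges (S2P H P))"
  using finite_T finite_K_edges by (simp add: S2P_edges)

text \<open>Besides its spoke, the vertex is incident with \<open>Across e\<close> for some edge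
  \<open>e\<close> inside \<open>T\<close> at \<open>x\<close>.\<close>

lemma Block_not_leaf:
  assumes "x \<in> T"
  shows "Block (rep x) (block x) \<notin> leaves (S2P H P)"
proof -
  obtain e where e: "e \<in> edges K" "x \<in> ends G e" by (rule ex_K_edge[OF assms])
  have "{Spoke (rep x) (block x), Across e} \<subseteq>
      {a \<in> edges (S2P H P). Block (rep x) (block x) \<in> ends (S2P H P) a}"
    using e assms by (simp add: S2P_edges S2P_ends_Spoke S2P_ends_Across)
  then show ?thesis
    unfolding leaves_iff[OF finite_S2P_edges] by (metis insert_subset s2p_edge.distinct(1) singletonD)
qed

text \<open>A base vertex that is not a leaf carries two blocks, so two vertices of \<open>T\<close>
  share their set \<open>N\<close>, which is then a singleton. This is needed because
  \<open>multiply_leaves\<close> makes a single copy of such a vertex.\<close>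

lemma mult_not_leaf:
  assumes b: "b \<in> verts (S2P H P)" "b \<notin> leaves (S2P H P)"
  shows "mult b = 1"
proof -
  consider x where "x \<in> T" "b = Base (rep x)" | x where "x \<in> T" "b = Block (rep x) (block x)"
    using b(1) by (auto simp: S2P_verts)
  then show ?thesis
  proof cases
    case 1
    have "\<exists>y\<in>T. y \<noteq> x \<and> rep y = rep x"
    proof (rule ccontr)
      assume "\<not> ?thesis"
      then have "{a \<in> edges (S2P H P). b \<in> ends (S2P H P) a} = {Spoke (rep x) (block x)}"
        using 1 by (auto simp: S2P_edges S2P_ends_Spoke S2P_ends_Across)
      moreover have "\<not> is_loop (S2P H P) (Spoke (rep x) (block x))"
        by (simp add: is_loop_def S2P_ends_Spoke)
      ultimately show False using b by (auto simp only: leaves_iff[OF finite_S2P_edges])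
    qed
    then obtain y where y: "y \<in> T" "y \<noteq> x" "rep y = rep x" by blast
    have "N x = {rep x}"
      using N_eq_singleton[OF 1(1) y(1) y(2)[symmetric]] rep_in 1(1) y(1,3) by metis
    then show ?thesis using 1 by (simp add: mult_def N_rep)
  qed (simp add: mult_def)
qed

lemma mult_pos:
  assumes "b \<in> verts (S2P H P)"
  shows "mult b > 0"
  using assms by (auto simp: S2P_verts mult_def N_rep card_gt_0_iff finite_N N_nonempty)

lemma S2PT_verts: "verts (S2PT H P mult) = {(b, i). b \<in> verts (S2P H P) \<and> i < mult b}"
  using mult_not_leaf by (auto simp: S2PT_def multiply_leaves_def split: if_splits)

text \<open>The only end of a spoke that can be a leaf is its base vertex; if that is no leaf,
  \<open>card (N x)\<close> is 1 and the count is still right. The edges \<open>Across e\<close>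
  meet no leaf.\<close>

lemma S2PT_edges:
  "edges (S2PT H P mult) =
    {(Spoke (rep x) (block x), i) |x i. x \<in> T \<and> i < card (N x)} \<union> {(Across e, 0) |e. e \<in> edges K}"
    (is "?L = ?R")
proof -
  have Spoke: "(Spoke (rep x) (block x), i) \<in> ?L \<longleftrightarrow> i < card (N x)" if x: "x \<in> T" for x i
  proof -
    have "Spoke (rep x) (block x) \<in> edges (S2P H P)" using x by (simp add: S2P_edges)
    moreover have "Base (rep x) \<in> verts (S2P H P)" using x by (simp add: S2P_verts)
    moreover have "mult (Base (rep x)) = card (N x)" using x by (simp add: mult_def N_rep)
    ultimately show ?thesis
      using Block_not_leaf[OF x] mult_not_leaf[of "Base (rep x)"]
      by (auto simp: S2PT_def multiply_leaves_def S2P_ends_Spoke)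
  qed
  have Across: "(Across e, i) \<in> ?L \<longleftrightarrow> i = 0" if e: "e \<in> edges K" for e i
  proof -
    have "ends G e \<subseteq> T" using e by (simp add: K_simps)
    then have "ends (S2P H P) (Across e) \<inter> leaves (S2P H P) = {}"
      using Block_not_leaf by (auto simp: S2P_ends_Across[OF e])
    moreover have "Across e \<in> edges (S2P H P)" using e by (simp add: S2P_edges)
    ultimately show ?thesis by (simp add: S2PT_def multiply_leaves_def)
  qed
  have "a \<in> ?L \<longleftrightarrow> a \<in> ?R" for a
  proof
    assume a: "a \<in> ?L"
    then have "fst a \<in> edges (S2P H P)" by (auto simp: S2PT_def multiply_leaves_def)
    then show "a \<in> ?R" using a Spoke Across by (cases a) (auto simp: S2P_edges)
  qed (use Spoke Across in auto)
  then show ?thesis by blast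
qed

lemma S2PT_ends:
  "ends (S2PT H P mult) (a, i) = (\<lambda>b. (b, if b \<in> leaves (S2P H P) then i else 0)) ` ends (S2P H P) a"
  by (simp add: S2PT_def multiply_leaves_def)

section \<open>The isomorphism from \<open>G\<close>\<close>

definition vmap :: "'v \<Rightarrow> ('v, 'e) s2p_vertex \<times> nat" where
  "vmap u = (if u \<in> T then (Block (rep u) (block u), 0) else (Base (rep (anchor u)), index u))"

lemma index_less: "d \<in> D \<Longrightarrow> index d < card (N (anchor d))"
  using bij_betwE[OF index_bij[OF anchor(1)]] anchor(2) by fastforce

text \<open>The representative determines the block of \<open>D\<close>, and \<open>index\<close> is
  injective on it.\<close>

lemma D_eqI:
  assumes "d \<in> D" "d' \<in> D" "rep (anchor d) = rep (anchor d')" "index d = index d'"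
  shows "d = d'"
proof -
  have "d' \<in> N (anchor d)" using assms by (simp add: in_N_iff anchor(1))
  then show ?thesis
    using bij_betw_imp_inj_on[OF index_bij[OF anchor(1)[OF assms(1)]]] anchor(2)[OF assms(1)] assms(4)
    by (auto dest: inj_onD)
qed

lemma ex_index:
  assumes "x \<in> T" "i < card (N x)"
  obtains d where "d \<in> N x" "d \<in> D" "index d = i"
proof -
  have "i \<in> index ` N x" using index_bij[OF assms(1)] assms(2) by (simp add: bij_betw_def)
  then show thesis using that assms(1) N_iff by blast
qed

lemma bij_vmap: "bij_betw vmap (verts G) (verts (S2PT H P mult))"
proof (rule bij_betw_imageI)
  have V: "verts G = T \<union> D" using D_eq TV by auto
  show "inj_on vmap (verts G)"
    unfolding V by (rule inj_onI) (auto simp: vmap_def block_eq_iff intro: D_eqI split: if_splits)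
  have "vmap ` T = (\<lambda>x. (Block (rep x) (block x), 0)) ` T"
    by (simp add: vmap_def)
  moreover have "vmap ` D = {(Base (rep x), i) |x i. x \<in> T \<and> i < card (N x)}"
  proof (intro equalityI subsetI)
    fix b assume "b \<in> vmap ` D"
    then obtain d where "d \<in> D" "b = (Base (rep (anchor d)), index d)"
      using disjoint by (auto simp: vmap_def)
    then show "b \<in> {(Base (rep x), i) |x i. x \<in> T \<and> i < card (N x)}"
      using index_less anchor(1) by blast
  next
    fix b :: "('v, 'e) s2p_vertex \<times> nat"
    assume "b \<in> {(Base (rep x), i) |x i. x \<in> T \<and> i < card (N x)}"
    then obtain x i where b: "b = (Base (rep x), i)" "x \<in> T" "i < card (N x)" by blast
    obtain d where d: "d \<in> N x" "d \<in> D" "index d = i" by (rule ex_index[OF b(2,3)])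
    then have "vmap d = b" using b rep_anchor[OF b(2) d(1)] disjoint by (auto simp: vmap_def)
    then show "b \<in> vmap ` D" using d(2) by blast
  qed
  ultimately show "vmap ` verts G = verts (S2PT H P mult)"
    by (auto simp: V image_Un S2PT_verts S2P_verts mult_def N_rep)
qed

text \<open>Like \<open>Dend\<close>, evaluated only at edges outside \<open>K\<close>, which have
  exactly one end in each of \<open>T\<close> and \<open>D\<close>.\<close>

definition Tend :: "'e \<Rightarrow> 'v" where
  "Tend e = (THE x. x \<in> ends G e \<inter> T)"

definition Dend :: "'e \<Rightarrow> 'v" where
  "Dend e = (THE d. d \<in> ends G e \<inter> D)"

definition emap :: "'e \<Rightarrow> ('v, 'e) s2p_edge \<times> nat" where
  "emap e = (if e \<in> edges K then (Across e, 0)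
    else (Spoke (rep (Tend e)) (block (Tend e)), index (Dend e)))"

lemma cross_ends:
  assumes "ends G e = {x, d}" "x \<in> T" "d \<in> D"
  shows "Tend e = x" "Dend e = d" "e \<notin> edges K"
  using assms disjoint by (auto simp: Tend_def Dend_def K_simps)

lemma emap_cross:
  assumes "ends G e = {x, d}" "x \<in> T" "d \<in> D"
  shows "emap e = (Spoke (rep x) (block x), index d)"
  using cross_ends[OF assms] by (simp add: emap_def)

lemma not_K_cross:
  assumes "e \<in> edges G" "e \<notin> edges K"
  obtains x d where "ends G e = {x, d}" "x \<in> T" "d \<in> D" "d \<in> N x"
  using assms(1)
proof (cases rule: edge_cases)
  case (inner u v)
  then show thesis using assms by (simp add: K_simps)
next
  case (cross x d)
  then have "d \<in> N x" using assms(1) by (auto simp: N_iff adjacent_def)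
  then show thesis using cross that by blast
qed

lemma bij_emap: "bij_betw emap (edges G) (edges (S2PT H P mult))"
proof (rule bij_betw_imageI)
  let ?X = "edges G - edges K"
  have E: "edges G = edges K \<union> ?X" by (auto simp: K_simps)
  have inj: "e = e'" if e: "e \<in> ?X" "e' \<in> ?X" "emap e = emap e'" for e e'
  proof -
    obtain x d where xd: "ends G e = {x, d}" "x \<in> T" "d \<in> D" "d \<in> N x"
      using e(1) by (auto elim: not_K_cross)
    obtain x' d' where xd': "ends G e' = {x', d'}" "x' \<in> T" "d' \<in> D" "d' \<in> N x'"
      using e(2) by (auto elim: not_K_cross)
    have x: "x = x'" and idx: "index d = index d'"
      using e(3) by (simp_all add: emap_cross[OF xd(1-3)] emap_cross[OF xd'(1-3)] block_eq_iff xd(2))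
    have "rep (anchor d) = rep (anchor d')"
      unfolding rep_anchor[OF xd(2,4)] rep_anchor[OF xd'(2,4)] x ..
    then have "d = d'" by (rule D_eqI[OF xd(3) xd'(3) _ idx])
    then have "ends G e' = {x, d}" using xd'(1) x by simp
    \<comment> \<open>Parallel edges may occur in a multigraph, but not between \<open>T\<close> and
      \<open>D\<close>, so the ends determine the edge.\<close>
    then show ?thesis using cross_parallel[OF _ _ _ xd(1-3)] e(1,2) by blast
  qed
  show "inj_on emap (edges G)"
  proof (rule inj_onI)
    fix e e' assume e: "e \<in> edges G" "e' \<in> edges G" "emap e = emap e'"
    show "e = e'"
    proof (cases "e \<in> edges K \<or> e' \<in> edges K")
      case True
      then show ?thesis using e(3) by (auto simp: emap_def split: if_splits)
    next
      case False
      then show ?thesis using e inj by simp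
    qed
  qed
  have "emap ` edges K = {(Across e, 0) |e. e \<in> edges K}"
    by (auto simp: emap_def)
  moreover have "emap ` ?X = {(Spoke (rep x) (block x), i) |x i. x \<in> T \<and> i < card (N x)}"
  proof (intro equalityI subsetI)
    fix a assume "a \<in> emap ` ?X"
    then obtain e where e: "e \<in> edges G" "e \<notin> edges K" "a = emap e" by blast
    obtain x d where xd: "ends G e = {x, d}" "x \<in> T" "d \<in> D" "d \<in> N x"
      by (rule not_K_cross[OF e(1,2)])
    have "index d < card (N x)" using index_less[OF xd(3)] N_anchor_eq[OF xd(2,4)] by simp
    then show "a \<in> {(Spoke (rep x) (block x), i) |x i. x \<in> T \<and> i < card (N x)}"
      using e(3) emap_cross[OF xd(1-3)] xd(2) by blast
  next
    fix a assume "a \<in> {(Spoke (rep x) (block x), i) |x i. x \<in> T \<and> i < card (N x)}"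
    then obtain x i where a: "a = (Spoke (rep x) (block x), i)" "x \<in> T" "i < card (N x)" by blast
    obtain d where d: "d \<in> N x" "d \<in> D" "index d = i" by (rule ex_index[OF a(2,3)])
    then obtain e where e: "e \<in> edges G" "ends G e = {x, d}"
      using a(2) by (auto simp: N_iff adjacent_def)
    have "emap e = a" using emap_cross[OF e(2) a(2) d(2)] d(3) a(1) by simp
    moreover have "e \<in> ?X" using e(1) cross_ends(3)[OF e(2) a(2) d(2)] by simp
    ultimately show "a \<in> emap ` ?X" by blast
  qed
  ultimately show "emap ` edges G = edges (S2PT H P mult)"
    unfolding S2PT_edges by (subst E) (simp only: image_Un Un_commute)
qed

lemma ends_emap:
  assumes "e \<in> edges G"
  shows "ends (S2PT H P mult) (emap e) = vmap ` ends G e"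
proof (cases "e \<in> edges K")
  case True
  then have "ends G e \<subseteq> T" by (simp add: K_simps)
  then show ?thesis using True
    by (auto simp: emap_def S2PT_ends S2P_ends_Across vmap_def image_image)
next
  case False
  obtain x d where xd: "ends G e = {x, d}" "x \<in> T" "d \<in> D" "d \<in> N x"
    by (rule not_K_cross[OF assms False])
  \<comment> \<open>A base vertex that is no leaf has only the copy 0, and \<open>ends\<close> uses
    that copy; here \<open>N x\<close> has one element, whose index is 0.\<close>
  have "index d = 0" if "Base (rep x) \<notin> leaves (S2P H P)"
  proof -
    have "mult (Base (rep x)) = 1" using xd(2) that by (intro mult_not_leaf) (auto simp: S2P_verts)
    then show ?thesis
      using index_less[OF xd(3)] xd(2) by (simp add: mult_def N_rep N_anchor_eq[OF xd(2,4)])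
  qed
  moreover have "d \<notin> T" using xd(3) disjoint by auto
  ultimately show ?thesis
    using Block_not_leaf[OF xd(2)] xd(2) rep_anchor[OF xd(2,4)]
    by (auto simp: emap_cross[OF xd(1-3)] S2PT_ends S2P_ends_Spoke xd(1) vmap_def)
qed

lemma isomorphic_S2PT: "isomorphic G (S2PT H P mult)"
  unfolding isomorphic_def using bij_vmap bij_emap ends_emap by blast

end

theorem theorem5p1:
  fixes G :: "('v, 'e) mgraph" and D T :: "'v set"
  assumes "multigraph G"
    and "minimal_DTDP G"
    and "DT_pair G D T"
  shows "maximal_independent G D
    \<and> (\<forall>C \<in> components (induced G T). is_star C \<or> is_one_vertex_one_loop C)
    \<and> (\<forall>x\<in>T. (card (nbrs G x - T) = 1 \<or> (nbrs G x - T \<noteq> {} \<and> nbrs G x - T \<subseteq> leaves G))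
         \<and> (\<forall>C \<in> components (induced G T).
              is_star C \<and> card (verts C) \<ge> 3 \<and> x \<in> leaves C
              \<longrightarrow> nbrs G x - T \<noteq> {} \<and> nbrs G x - T \<subseteq> leaves G))
    \<and> (\<exists>(H :: ('v, 'e) mgraph) P \<theta>.
         multigraph H \<and> gconnected H \<and> S2_family H P
         \<and> (\<forall>x \<in> leaves (S2P H P). \<theta> x > 0)
         \<and> isomorphic G (S2PT H P \<theta>))"
proof -
  interpret minimal_DT G D T using assms by unfold_locales
  have "\<forall>x \<in> leaves (S2P H P). mult x > 0"
    using mult_pos by (simp add: leaves_def)
  then have "\<exists>(H :: ('v, 'e) mgraph) P \<theta>.
         multigraph H \<and> gconnected H \<and> S2_family H P
         \<and> (\<forall>x \<in> leaves (S2P H P). \<theta> x > 0)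
         \<and> isomorphic G (S2PT H P \<theta>)"
    using multigraph_H gconnected_H S2_family_P isomorphic_S2PT by blast
  then show ?thesis
    using maximal_independent component_star_or_loop D_nbrs_cases star_leaf_nbrs by blast
qed

end
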